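(* Let $(\Omega,\Sigma,\mu)$ be a $\sigma$-finite complete nonatomic measure space, let $\Phi_1,\Phi_2$ be Young functions, and let $\varphi:\Omega\to\Omega$ be a surjective nonsingular measurable transformation. Let $h=\frac{d\mu\circ\varphi^{-1}}{d\mu}$ be the Radon-Nikodym derivative. Then the following conditions are equivalent: (a) The composition operator $C_\varphi$, $C_\varphi f=f\circ\varphi$, is bounded from $L^{\Phi_1}(\Omega)$ into $L^{\Phi_2}(\Omega)$. (b) The Orlicz space $L^{\Phi_1}(\Omega)$ is embedded continuously into the weighted Orlicz space $L_h^{\Phi_2}(\Omega)$. (c) There are $a,b>0$, $g\in L^1(\Omega)$ (real-valued) and a set $A\in\Sigma$ with $\mu(A)=0$ such that $\Phi_2(au)h(t)\le b\,\Phi_1(u)+g(t)$ for all $u>0$ and all $t\in\Omega\setminus A$.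
   Context: A Young function is a continuous convex function $\Phi:\mathbb{R}\to\mathbb{R}^+=[0,\infty)$ such that $\Phi(x)=0$ iff $x=0$, $\lim_{x\to\infty}\Phi(x)=\infty$ and $\lim_{x\to\infty}\Phi(x)/x=\infty$. For a Young function $\Phi$, the Orlicz space $L^\Phi(\Omega)=L^\Phi(\Omega,\Sigma,\mu)$ is the set of ($\mu$-a.e. classes of) $\Sigma$-measurable $f:\Omega\to\mathbb{C}$ such that $\int_\Omega\Phi(k|f|)\,d\mu<\infty$ for some $k>0$. It is a Banach space with norm $N_\Phi(f)=\inf\{k>0:\int_\Omega\Phi(|f|/k)\,d\mu\le 1\}$. A map $\varphi:\Omega\to\Omega$ is a measurable transformation if $\varphi^{-1}(A)\in\Sigma$ for all $A\in\Sigma$; it is nonsingular if $\mu(\varphi^{-1}(A))=0$ whenever $A\in\Sigma$ and $\mu(A)=0$. The Radon-Nikodym derivative $h$ is a nonnegative locally integrable function (in the sense that $\Omega$ is a countable union of measurable sets of finite measure on each of which $h$ is integrable) with $\mu(\varphi^{-1}(A))=\int_A h\,d\mu$ for all $A\in\Sigma$. $C_\varphi$ is bounded from $L^{\Phi_1}(\Omega)$ into $L^{\Phi_2}(\Omega)$ means that it maps $L^{\Phi_1}(\Omega)$ into $L^{\Phi_2}(\Omega)$ and there is $C>0$ with $N_{\Phi_2}(f\circ\varphi)\le C\,N_{\Phi_1}(f)$ for all $f\in L^{\Phi_1}(\Omega)$. The weighted Orlicz space $L_h^{\Phi_2}(\Omega)$ is the set of measurable $f:\Omega\to\mathbb{C}$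 such that $\int_\Omega h\,\Phi_2(k|f|)\,d\mu<\infty$ for some $k>0$, with $N_{\Phi_2,h}(f)=\inf\{k>0:\int_\Omega h\,\Phi_2(|f|/k)\,d\mu\le1\}$. Continuous embedding means: every $f\in L^{\Phi_1}(\Omega)$ belongs to $L_h^{\Phi_2}(\Omega)$ and there is $C>0$ with $N_{\Phi_2,h}(f)\le C\,N_{\Phi_1}(f)$ for all such $f$. *)

theory Defs
  imports "HOL-Analysis.Analysis"
begin

definition young_function :: "(real \<Rightarrow> real) \<Rightarrow> bool" where
  "young_function \<Phi> \<longleftrightarrow>
     (\<forall>x. 0 \<le> \<Phi> x) \<and>
     continuous_on UNIV \<Phi> \<and>
     convex_on UNIV \<Phi> \<and>
     (\<forall>x. \<Phi> x = 0 \<longleftrightarrow> x = 0) \<and>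
     filterlim \<Phi> at_top at_top \<and>
     filterlim (\<lambda>x. \<Phi> x / x) at_top at_top"

text \<open>Elements of the Orlicz spaces are represented by functions rather than by almost everywhere
  classes; membership and the norms below do not distinguish functions that agree almost everywhere.
  The infimum defining the norm is taken over a nonempty set of reals whenever the function belongs
  to the corresponding space, and the norms are used only there.\<close>

definition orlicz_space :: "'a measure \<Rightarrow> (real \<Rightarrow> real) \<Rightarrow> ('a \<Rightarrow> complex) set" where
  "orlicz_space M \<Phi> =
     {f \<in> borel_measurable M. \<exists>k>0. (\<integral>\<^sup>+t. ennreal (\<Phi> (k * norm (f t))) \<partial>M) < \<infinity>}"

definition orlicz_norm :: "'a measure \<Rightarrow> (real \<Rightarrow> real) \<Rightarrow> ('a \<Rightarrow> complex) \<Rightarrow> real" where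
  "orlicz_norm M \<Phi> f =
     Inf {k. 0 < k \<and> (\<integral>\<^sup>+t. ennreal (\<Phi> (norm (f t) / k)) \<partial>M) \<le> 1}"

definition weighted_orlicz_space ::
    "'a measure \<Rightarrow> ('a \<Rightarrow> real) \<Rightarrow> (real \<Rightarrow> real) \<Rightarrow> ('a \<Rightarrow> complex) set" where
  "weighted_orlicz_space M h \<Phi> =
     {f \<in> borel_measurable M. \<exists>k>0. (\<integral>\<^sup>+t. ennreal (h t * \<Phi> (k * norm (f t))) \<partial>M) < \<infinity>}"

definition weighted_orlicz_norm ::
    "'a measure \<Rightarrow> ('a \<Rightarrow> real) \<Rightarrow> (real \<Rightarrow> real) \<Rightarrow> ('a \<Rightarrow> complex) \<Rightarrow> real" where
  "weighted_orlicz_norm M h \<Phi> f =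
     Inf {k. 0 < k \<and> (\<integral>\<^sup>+t. ennreal (h t * \<Phi> (norm (f t) / k)) \<partial>M) \<le> 1}"

definition nonatomic :: "'a measure \<Rightarrow> bool" where
  "nonatomic M \<longleftrightarrow>
     (\<forall>A\<in>sets M. 0 < emeasure M A \<longrightarrow>
        (\<exists>B\<in>sets M. B \<subseteq> A \<and> 0 < emeasure M B \<and> emeasure M B < emeasure M A))"

definition nonsingular :: "'a measure \<Rightarrow> ('a \<Rightarrow> 'a) \<Rightarrow> bool" where
  "nonsingular M \<phi> \<longleftrightarrow>
     (\<forall>A\<in>sets M. emeasure M A = 0 \<longrightarrow> emeasure M (\<phi> -` A \<inter> space M) = 0)"

definition locally_integrable :: "'a measure \<Rightarrow> ('a \<Rightarrow> real) \<Rightarrow> bool" where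
  "locally_integrable M h \<longleftrightarrow>
     (\<exists>F :: nat \<Rightarrow> 'a set. (\<Union>n. F n) = space M \<and>
        (\<forall>n. F n \<in> sets M \<and> emeasure M (F n) < \<infinity> \<and> set_integrable M (F n) h))"

text \<open>The function \<open>h\<close> is a finite-valued version of the Radon--Nikodym derivative of
  \<open>distr M M \<phi>\<close> with respect to \<open>M\<close>.  The library's \<^const>\<open>RN_deriv\<close> is one fixed,
  extended-valued version; the two agree almost everywhere, as shown below.\<close>

definition radon_nikodym_of :: "'a measure \<Rightarrow> ('a \<Rightarrow> 'a) \<Rightarrow> ('a \<Rightarrow> real) \<Rightarrow> bool" where
  "radon_nikodym_of M \<phi> h \<longleftrightarrow>
     h \<in> borel_measurable M \<and>
     (\<forall>t\<in>space M. 0 \<le> h t) \<and>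
     locally_integrable M h \<and>
     (\<forall>A\<in>sets M. emeasure M (\<phi> -` A \<inter> space M) = (\<integral>\<^sup>+t\<in>A. ennreal (h t) \<partial>M))"

lemma radon_nikodym_of_AE_RN_deriv:
  assumes "sigma_finite_measure M" "\<phi> \<in> measurable M M" "radon_nikodym_of M \<phi> h"
  shows "AE t in M. ennreal (h t) = RN_deriv M (distr M M \<phi>) t"
proof (rule sigma_finite_measure.RN_deriv_unique[OF assms(1)])
  have h: "h \<in> borel_measurable M"
    using assms(3) by (simp add: radon_nikodym_of_def)
  then show "(\<lambda>t. ennreal (h t)) \<in> borel_measurable M"
    by measurable
  show "density M (\<lambda>t. ennreal (h t)) = distr M M \<phi>"
    using assms(2,3) h
    by (intro measure_eqI) (auto simp: emeasure_density emeasure_distr radon_nikodym_of_def)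
qed

definition composition_bounded ::
    "'a measure \<Rightarrow> (real \<Rightarrow> real) \<Rightarrow> (real \<Rightarrow> real) \<Rightarrow> ('a \<Rightarrow> 'a) \<Rightarrow> bool" where
  "composition_bounded M \<Phi>1 \<Phi>2 \<phi> \<longleftrightarrow>
     (\<forall>f\<in>orlicz_space M \<Phi>1. f \<circ> \<phi> \<in> orlicz_space M \<Phi>2) \<and>
     (\<exists>C>0. \<forall>f\<in>orlicz_space M \<Phi>1. orlicz_norm M \<Phi>2 (f \<circ> \<phi>) \<le> C * orlicz_norm M \<Phi>1 f)"

definition continuously_embedded_weighted ::
    "'a measure \<Rightarrow> (real \<Rightarrow> real) \<Rightarrow> ('a \<Rightarrow> real) \<Rightarrow> (real \<Rightarrow> real) \<Rightarrow> bool" where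
  "continuously_embedded_weighted M \<Phi>1 h \<Phi>2 \<longleftrightarrow>
     orlicz_space M \<Phi>1 \<subseteq> weighted_orlicz_space M h \<Phi>2 \<and>
     (\<exists>C>0. \<forall>f\<in>orlicz_space M \<Phi>1. weighted_orlicz_norm M h \<Phi>2 f \<le> C * orlicz_norm M \<Phi>1 f)"

end

theory Submission
  imports Defs
begin

text \<open>Integrating a composition \<open>F \<circ> \<phi>\<close> amounts to integrating \<open>F\<close> against the image measure, which
  is \<open>h\<close> times the original one.  The modulars \<open>\<integral> \<Phi>2 (k * norm (f \<circ> \<phi>))\<close> and
  \<open>\<integral> h * \<Phi>2 (k * norm f)\<close> therefore coincide for every \<open>k\<close>, so that boundedness of the composition
  operator and continuity of the embedding are the same statement
  (\<open>composition_bounded_iff_embedded\<close>).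

  The pointwise inequality, applied to \<open>u = norm (f t) / k\<close> and integrated, bounds the weighted modular of
  \<open>a * f / k\<close> by a constant as soon as the \<open>\<Phi>1\<close>-modular of \<open>f / k\<close> is at most one.  Convexity of
  \<open>\<Phi>2\<close> absorbs the constant into the norm (\<open>embedded_if_pointwise_inequality\<close>).

  For the converse, the embedding yields \<open>a > 0\<close> such that \<open>\<integral> \<Phi>1 (x) \<le> 1\<close> implies
  \<open>\<integral> h * \<Phi>2 (a * x) \<le> 1\<close>.  The smallest possible \<open>g\<close> for \<open>b = 2\<close> is the supremum over \<open>u\<close> of the excess
  \<open>e t u = h t * \<Phi>2 (a * u) - 2 * \<Phi>1 u\<close>, and what has to be shown is that it is integrable.  By
  continuity the supremum may be taken over a countable dense set, so it is the increasing limit of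
  \<open>e t (f n t)\<close>, where \<open>f n t\<close> is the best among finitely many candidates.  On a set \<open>E\<close> with
  \<open>\<integral>\<^bsub>E\<^esub> \<Phi>1 (f n) \<le> 1\<close> the embedding gives
  \<open>2 * \<integral>\<^bsub>E\<^esub> \<Phi>1 (f n) + \<integral>\<^bsub>E\<^esub> e (f n) = \<integral>\<^bsub>E\<^esub> h * \<Phi>2 (a * f n) \<le> 1\<close>, hence
  \<open>\<integral>\<^bsub>E\<^esub> \<Phi>1 (f n) \<le> 1 / 2\<close>.  So the measure \<open>E \<mapsto> \<integral>\<^bsub>E\<^esub> \<Phi>1 (f n)\<close> takes no value in \<open>{1 / 2<..1}\<close>.  A
  nonatomic measure cannot jump over such an interval (\<open>nn_integral_le_if_gap\<close>), so its total mass is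
  at most \<open>1 / 2\<close>.  Then \<open>E\<close> can be the whole space, \<open>\<integral> e (f n) \<le> 1\<close> for every \<open>n\<close>, and
  monotone convergence bounds the integral of the supremum.\<close>

section \<open>Young functions\<close>

lemma young_function_zero: "young_function \<Phi> \<Longrightarrow> \<Phi> 0 = 0"
  by (simp add: young_function_def)

lemma young_function_nonneg: "young_function \<Phi> \<Longrightarrow> 0 \<le> \<Phi> x"
  by (simp add: young_function_def)

lemma young_function_continuous_on:
  "young_function \<Phi> \<Longrightarrow> continuous_on S f \<Longrightarrow> continuous_on S (\<lambda>x. \<Phi> (f x))"
  by (rule continuous_on_compose2[of UNIV \<Phi>]) (auto simp: young_function_def)

lemma young_function_borel_measurable:
  "young_function \<Phi> \<Longrightarrow> \<Phi> \<in> borel_measurable borel"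
  by (simp add: young_function_def borel_measurable_continuous_onI)

lemma young_function_scale_le:
  assumes "young_function \<Phi>" "0 \<le> l" "l \<le> 1"
  shows "\<Phi> (l * x) \<le> l * \<Phi> x"
proof -
  have "\<Phi> ((1 - l) *\<^sub>R 0 + l *\<^sub>R x) \<le> (1 - l) * \<Phi> 0 + l * \<Phi> x"
    using assms convex_onD[of UNIV \<Phi> l 0 x] by (auto simp: young_function_def)
  then show ?thesis
    using assms(1) by (simp add: young_function_zero)
qed

lemma young_function_mono:
  assumes "young_function \<Phi>" "0 \<le> x" "x \<le> y"
  shows "\<Phi> x \<le> \<Phi> y"
proof (cases "y = 0")
  case True
  then show ?thesis using assms by simp
next
  case False
  then have y: "0 < y" using assms by linarith
  have "\<Phi> x = \<Phi> ((x / y) * y)"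
    using y by simp
  also have "\<dots> \<le> (x / y) * \<Phi> y"
    using assms y by (intro young_function_scale_le) auto
  also have "\<dots> \<le> 1 * \<Phi> y"
    using assms y young_function_nonneg[OF assms(1)] by (intro mult_right_mono) auto
  finally show ?thesis by simp
qed

section \<open>Modulars and Luxemburg norms\<close>

text \<open>The unweighted space is the case of constant weight one, so facts about modulars and norms
  of weighted spaces cover both.\<close>

lemma orlicz_space_eq_weighted: "orlicz_space M \<Phi> = weighted_orlicz_space M (\<lambda>_. 1) \<Phi>"
  by (simp add: orlicz_space_def weighted_orlicz_space_def)

lemma orlicz_norm_eq_weighted: "orlicz_norm M \<Phi> f = weighted_orlicz_norm M (\<lambda>_. 1) \<Phi> f"
  by (simp add: orlicz_norm_def weighted_orlicz_norm_def)

text \<open>Convexity turns any finite bound on the modular into the bound one, at the price of dividing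
  the function by that bound.\<close>

lemma modular_divide_le_one:
  assumes \<Phi>: "young_function \<Phi>" and h: "h \<in> borel_measurable M" "\<And>t. t \<in> space M \<Longrightarrow> 0 \<le> h t"
    and x: "x \<in> borel_measurable M"
    and D: "1 \<le> D" "(\<integral>\<^sup>+t. ennreal (h t * \<Phi> (x t)) \<partial>M) \<le> ennreal D"
  shows "(\<integral>\<^sup>+t. ennreal (h t * \<Phi> (x t / D)) \<partial>M) \<le> 1"
proof -
  note [measurable] = young_function_borel_measurable[OF \<Phi>] h(1) x
  have "(\<integral>\<^sup>+t. ennreal (h t * \<Phi> (x t / D)) \<partial>M) \<le> (\<integral>\<^sup>+t. ennreal (1 / D) * ennreal (h t * \<Phi> (x t)) \<partial>M)"
  proof (rule nn_integral_mono)
    fix t assume t: "t \<in> space M"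
    have "\<Phi> ((1 / D) * x t) \<le> (1 / D) * \<Phi> (x t)"
      using D(1) by (intro young_function_scale_le[OF \<Phi>]) auto
    then have "h t * \<Phi> (x t / D) \<le> h t * ((1 / D) * \<Phi> (x t))"
      using h(2)[OF t] by (intro mult_left_mono) auto
    then have "h t * \<Phi> (x t / D) \<le> (1 / D) * (h t * \<Phi> (x t))"
      by (simp add: mult.left_commute)
    then show "ennreal (h t * \<Phi> (x t / D)) \<le> ennreal (1 / D) * ennreal (h t * \<Phi> (x t))"
      using D(1) h(2)[OF t] young_function_nonneg[OF \<Phi>]
      by (subst ennreal_mult[symmetric]) (auto intro: ennreal_leI)
  qed
  also have "\<dots> = ennreal (1 / D) * (\<integral>\<^sup>+t. ennreal (h t * \<Phi> (x t)) \<partial>M)"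
    by (rule nn_integral_cmult) measurable
  also have "\<dots> \<le> ennreal (1 / D) * ennreal D"
    by (intro mult_left_mono D) auto
  also have "\<dots> = 1"
    using D(1) by (subst ennreal_mult[symmetric]) auto
  finally show ?thesis .
qed

text \<open>The infimum of the empty set of reals is an arbitrary number, so a norm carries information only
  once a witness is at hand.\<close>

lemma weighted_orlicz_norm_witness:
  assumes \<Phi>: "young_function \<Phi>" and h: "h \<in> borel_measurable M" "\<And>t. t \<in> space M \<Longrightarrow> 0 \<le> h t"
    and f: "f \<in> weighted_orlicz_space M h \<Phi>"
  shows "{k. 0 < k \<and> (\<integral>\<^sup>+t. ennreal (h t * \<Phi> (norm (f t) / k)) \<partial>M) \<le> 1} \<noteq> {}"
proof -
  obtain k where k: "0 < k" "(\<integral>\<^sup>+t. ennreal (h t * \<Phi> (k * norm (f t))) \<partial>M) < \<infinity>"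
    and [measurable]: "f \<in> borel_measurable M"
    using f by (auto simp: weighted_orlicz_space_def)
  define I where "I = (\<integral>\<^sup>+t. ennreal (h t * \<Phi> (k * norm (f t))) \<partial>M)"
  define D where "D = max 1 (enn2real I)"
  have "I = ennreal (enn2real I)"
    using k(2) by (simp add: I_def less_top)
  also have "\<dots> \<le> ennreal D"
    by (intro ennreal_leI) (simp add: D_def)
  finally have "(\<integral>\<^sup>+t. ennreal (h t * \<Phi> (k * norm (f t) / D)) \<partial>M) \<le> 1"
    by (intro modular_divide_le_one[OF \<Phi> h]) (auto simp: I_def D_def)
  then have "(\<integral>\<^sup>+t. ennreal (h t * \<Phi> (norm (f t) / (D / k))) \<partial>M) \<le> 1"
    by (simp add: mult.commute)
  moreover have "0 < D / k"
    using k(1) by (simp add: D_def)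
  ultimately show ?thesis by blast
qed

lemma weighted_orlicz_norm_le:
  assumes "0 < k" "(\<integral>\<^sup>+t. ennreal (h t * \<Phi> (norm (f t) / k)) \<partial>M) \<le> 1"
  shows "weighted_orlicz_norm M h \<Phi> f \<le> k"
  unfolding weighted_orlicz_norm_def
  using assms by (intro cInf_lower bdd_belowI[of _ 0]) auto

text \<open>Some \<open>k < c\<close> lies in the set defining the norm, and the modular decreases when the divisor
  grows.\<close>

lemma modular_le_one_if_norm_less:
  assumes \<Phi>: "young_function \<Phi>" and h: "h \<in> borel_measurable M" "\<And>t. t \<in> space M \<Longrightarrow> 0 \<le> h t"
    and f: "f \<in> weighted_orlicz_space M h \<Phi>" and c: "weighted_orlicz_norm M h \<Phi> f < c"
  shows "(\<integral>\<^sup>+t. ennreal (h t * \<Phi> (norm (f t) / c)) \<partial>M) \<le> 1"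
proof -
  obtain k where k: "0 < k" "k < c" "(\<integral>\<^sup>+t. ennreal (h t * \<Phi> (norm (f t) / k)) \<partial>M) \<le> 1"
    using cInf_lessD[OF weighted_orlicz_norm_witness[OF \<Phi> h f]] c
    by (auto simp: weighted_orlicz_norm_def)
  have "(\<integral>\<^sup>+t. ennreal (h t * \<Phi> (norm (f t) / c)) \<partial>M) \<le> (\<integral>\<^sup>+t. ennreal (h t * \<Phi> (norm (f t) / k)) \<partial>M)"
    using k h(2)
    by (intro nn_integral_mono ennreal_leI mult_left_mono young_function_mono[OF \<Phi>])
       (auto intro: divide_left_mono)
  with k(3) show ?thesis by simp
qed

section \<open>Change of variables\<close>

lemma nn_integral_comp_radon_nikodym:
  assumes \<phi>: "\<phi> \<in> measurable M M" and h: "radon_nikodym_of M \<phi> h"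
    and \<Phi>: "young_function \<Phi>" and x: "x \<in> borel_measurable M"
  shows "(\<integral>\<^sup>+t. ennreal (\<Phi> (x (\<phi> t))) \<partial>M) = (\<integral>\<^sup>+t. ennreal (h t * \<Phi> (x t)) \<partial>M)"
proof -
  have [measurable]: "h \<in> borel_measurable M"
    using h by (simp add: radon_nikodym_of_def)
  note [measurable] = young_function_borel_measurable[OF \<Phi>] x \<phi>
  have distr: "distr M M \<phi> = density M (\<lambda>t. ennreal (h t))"
    using \<phi> h by (intro measure_eqI) (auto simp: emeasure_density emeasure_distr radon_nikodym_of_def)
  have "(\<integral>\<^sup>+t. ennreal (\<Phi> (x (\<phi> t))) \<partial>M) = (\<integral>\<^sup>+t. ennreal (\<Phi> (x t)) \<partial>distr M M \<phi>)"
    by (subst nn_integral_distr) auto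
  also have "\<dots> = (\<integral>\<^sup>+t. ennreal (h t) * ennreal (\<Phi> (x t)) \<partial>M)"
    unfolding distr by (subst nn_integral_density) auto
  also have "\<dots> = (\<integral>\<^sup>+t. ennreal (h t * \<Phi> (x t)) \<partial>M)"
    using h by (intro nn_integral_cong ennreal_mult'[symmetric]) (auto simp: radon_nikodym_of_def)
  finally show ?thesis .
qed

text \<open>Membership and the norm depend on a function through its modulars only, and these do not change
  when composition with \<open>\<phi>\<close> is traded for the weight \<open>h\<close>.\<close>

lemma composition_bounded_iff_embedded:
  assumes \<phi>: "\<phi> \<in> measurable M M" and h: "radon_nikodym_of M \<phi> h" and \<Phi>2: "young_function \<Phi>2"
  shows "composition_bounded M \<Phi>1 \<Phi>2 \<phi> \<longleftrightarrow> continuously_embedded_weighted M \<Phi>1 h \<Phi>2"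
proof -
  have "f \<circ> \<phi> \<in> orlicz_space M \<Phi>2 \<longleftrightarrow> f \<in> weighted_orlicz_space M h \<Phi>2"
       "orlicz_norm M \<Phi>2 (f \<circ> \<phi>) = weighted_orlicz_norm M h \<Phi>2 f"
    if f: "f \<in> orlicz_space M \<Phi>1" for f
  proof -
    have [measurable]: "f \<in> borel_measurable M"
      using f by (simp add: orlicz_space_def)
    have "f \<circ> \<phi> \<in> borel_measurable M"
      using \<phi> by (intro measurable_comp[of _ _ M]) auto
    moreover have "(\<integral>\<^sup>+t. ennreal (\<Phi>2 (k * norm (f (\<phi> t)))) \<partial>M) =
        (\<integral>\<^sup>+t. ennreal (h t * \<Phi>2 (k * norm (f t))) \<partial>M)" for k
      by (rule nn_integral_comp_radon_nikodym[OF \<phi> h \<Phi>2]) measurable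
    ultimately show "f \<circ> \<phi> \<in> orlicz_space M \<Phi>2 \<longleftrightarrow> f \<in> weighted_orlicz_space M h \<Phi>2"
      by (simp add: orlicz_space_def weighted_orlicz_space_def)
    have "(\<integral>\<^sup>+t. ennreal (\<Phi>2 (norm (f (\<phi> t)) / k)) \<partial>M) =
        (\<integral>\<^sup>+t. ennreal (h t * \<Phi>2 (norm (f t) / k)) \<partial>M)" for k
      by (rule nn_integral_comp_radon_nikodym[OF \<phi> h \<Phi>2]) measurable
    then show "orlicz_norm M \<Phi>2 (f \<circ> \<phi>) = weighted_orlicz_norm M h \<Phi>2 f"
      by (simp add: orlicz_norm_def weighted_orlicz_norm_def)
  qed
  then show ?thesis
    unfolding composition_bounded_def continuously_embedded_weighted_def by auto
qed

section \<open>From the pointwise inequality to the embedding\<close>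

lemma embedded_if_pointwise_inequality:
  assumes \<Phi>1: "young_function \<Phi>1" and \<Phi>2: "young_function \<Phi>2"
    and h: "h \<in> borel_measurable M" "\<And>t. t \<in> space M \<Longrightarrow> 0 \<le> h t"
    and a: "0 < a" and b: "0 < b" and g: "integrable M g"
    and A: "A \<in> sets M" "emeasure M A = 0"
    and ineq: "\<And>u t. 0 < u \<Longrightarrow> t \<in> space M - A \<Longrightarrow> \<Phi>2 (a * u) * h t \<le> b * \<Phi>1 u + g t"
  shows "continuously_embedded_weighted M \<Phi>1 h \<Phi>2"
proof -
  note [measurable] = young_function_borel_measurable[OF \<Phi>1] young_function_borel_measurable[OF \<Phi>2]
    h(1) borel_measurable_integrable[OF g]
  define G where "G = (\<integral>t. \<bar>g t\<bar> \<partial>M)"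
  have G: "(\<integral>\<^sup>+t. ennreal \<bar>g t\<bar> \<partial>M) = ennreal G"
    unfolding G_def using g by (intro nn_integral_eq_integral) auto
  have modular: "(\<integral>\<^sup>+t. ennreal (h t * \<Phi>2 (a * x t)) \<partial>M)
      \<le> ennreal b * (\<integral>\<^sup>+t. ennreal (\<Phi>1 (x t)) \<partial>M) + ennreal G"
    if [measurable]: "x \<in> borel_measurable M" and x: "\<And>t. 0 \<le> x t" for x
  proof -
    have "AE t in M. t \<notin> A"
      using A by (intro AE_not_in) (auto simp: null_sets_def)
    then have "(\<integral>\<^sup>+t. ennreal (h t * \<Phi>2 (a * x t)) \<partial>M)
        \<le> (\<integral>\<^sup>+t. ennreal b * ennreal (\<Phi>1 (x t)) + ennreal \<bar>g t\<bar> \<partial>M)"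
    proof (rule nn_integral_mono_AE[OF AE_mp], intro AE_I2 impI)
      fix t assume t: "t \<in> space M" "t \<notin> A"
      have "h t * \<Phi>2 (a * x t) \<le> b * \<Phi>1 (x t) + \<bar>g t\<bar>"
      proof (cases "x t = 0")
        case True
        then show ?thesis
          by (simp add: young_function_zero[OF \<Phi>1] young_function_zero[OF \<Phi>2])
      next
        case False
        then have "0 < x t" using x[of t] by linarith
        from ineq[OF this, of t] t show ?thesis by (simp add: mult.commute)
      qed
      then show "ennreal (h t * \<Phi>2 (a * x t)) \<le> ennreal b * ennreal (\<Phi>1 (x t)) + ennreal \<bar>g t\<bar>"
        using b young_function_nonneg[OF \<Phi>1]
        by (simp add: ennreal_mult[symmetric] ennreal_plus[symmetric] ennreal_leI del: ennreal_plus)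
    qed
    also have "\<dots> = ennreal b * (\<integral>\<^sup>+t. ennreal (\<Phi>1 (x t)) \<partial>M) + ennreal G"
      by (simp add: nn_integral_add nn_integral_cmult G)
    finally show ?thesis .
  qed
  (* b + G bounds the weighted modular of a * f / k when the modular of f / k is at most one; the
     maximum with 1 makes it admissible as a divisor in modular_divide_le_one. *)
  define D where "D = max 1 (b + G)"
  have D: "1 \<le> D" by (simp add: D_def)
  have G0: "0 \<le> G" by (simp add: G_def)
  have norm: "weighted_orlicz_norm M h \<Phi>2 f \<le> (D / a) * k"
    if [measurable]: "f \<in> borel_measurable M" and k: "0 < k"
      and k1: "(\<integral>\<^sup>+t. ennreal (\<Phi>1 (norm (f t) / k)) \<partial>M) \<le> 1" for f :: "'a \<Rightarrow> complex" and k
  proof -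
    have "(\<integral>\<^sup>+t. ennreal (h t * \<Phi>2 (a * (norm (f t) / k))) \<partial>M)
        \<le> ennreal b * (\<integral>\<^sup>+t. ennreal (\<Phi>1 (norm (f t) / k)) \<partial>M) + ennreal G"
      using k by (intro modular) auto
    also have "\<dots> \<le> ennreal b * 1 + ennreal G"
      by (intro add_right_mono mult_left_mono k1) auto
    also have "\<dots> \<le> ennreal D"
      using b G0 by (simp add: ennreal_plus[symmetric] D_def ennreal_leI del: ennreal_plus)
    finally have "(\<integral>\<^sup>+t. ennreal (h t * \<Phi>2 (a * (norm (f t) / k) / D)) \<partial>M) \<le> 1"
      by (intro modular_divide_le_one[OF \<Phi>2 h _ D]) auto
    then have "(\<integral>\<^sup>+t. ennreal (h t * \<Phi>2 (norm (f t) / ((D / a) * k))) \<partial>M) \<le> 1"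
      using a k D by (simp add: field_simps)
    then show ?thesis
      using a k D by (intro weighted_orlicz_norm_le) auto
  qed
  show ?thesis
    unfolding continuously_embedded_weighted_def
  proof (intro conjI exI[of _ "D / a"] ballI subsetI)
    show "0 < D / a" using a D by simp
  next
    fix f assume f: "f \<in> orlicz_space M \<Phi>1"
    then obtain k where [measurable]: "f \<in> borel_measurable M"
      and k: "0 < k" "(\<integral>\<^sup>+t. ennreal (\<Phi>1 (k * norm (f t))) \<partial>M) < \<infinity>"
      by (auto simp: orlicz_space_def)
    have "(\<integral>\<^sup>+t. ennreal (h t * \<Phi>2 (a * (k * norm (f t)))) \<partial>M)
        \<le> ennreal b * (\<integral>\<^sup>+t. ennreal (\<Phi>1 (k * norm (f t))) \<partial>M) + ennreal G"
      using k by (intro modular) auto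
    also have "\<dots> < \<infinity>"
      using k(2) by (simp add: ennreal_mult_less_top)
    finally show "f \<in> weighted_orlicz_space M h \<Phi>2"
      using a k(1) by (auto simp: weighted_orlicz_space_def mult.assoc intro!: exI[of _ "a * k"])
  next
    fix f assume f: "f \<in> orlicz_space M \<Phi>1"
    then have [measurable]: "f \<in> borel_measurable M"
      by (simp add: orlicz_space_def)
    have Da: "0 < D / a" using a D by simp
    have "{k. 0 < k \<and> (\<integral>\<^sup>+t. ennreal (\<Phi>1 (norm (f t) / k)) \<partial>M) \<le> 1} \<noteq> {}"
      using weighted_orlicz_norm_witness[OF \<Phi>1, of "\<lambda>_. 1" M f] f
      by (simp add: orlicz_space_eq_weighted)
    then have "weighted_orlicz_norm M h \<Phi>2 f / (D / a) \<le> orlicz_norm M \<Phi>1 f"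
      unfolding orlicz_norm_def
    proof (rule cInf_greatest)
      fix k assume "k \<in> {k. 0 < k \<and> (\<integral>\<^sup>+t. ennreal (\<Phi>1 (norm (f t) / k)) \<partial>M) \<le> 1}"
      then have "weighted_orlicz_norm M h \<Phi>2 f \<le> k * (D / a)"
        using norm[of f k] by (simp add: mult.commute)
      then show "weighted_orlicz_norm M h \<Phi>2 f / (D / a) \<le> k"
        using Da by (subst pos_divide_le_eq)
    qed
    then show "weighted_orlicz_norm M h \<Phi>2 f \<le> (D / a) * orlicz_norm M \<Phi>1 f"
      using Da by (subst (asm) pos_divide_le_eq) (auto simp: mult.commute)
  qed
qed

section \<open>Small sets in nonatomic measure spaces\<close>

text \<open>Sigma-finiteness provides a subset of positive finite measure.  When such a set is split into two
  parts of positive measure, one of them has at most half the measure, and repeated halving gets below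
  every positive bound.\<close>

lemma nonatomic_small_subset:
  assumes sf: "sigma_finite_measure M" and na: "nonatomic M"
    and A: "A \<in> sets M" "0 < emeasure M A" and e: "0 < (e::real)"
  shows "\<exists>B\<in>sets M. B \<subseteq> A \<and> 0 < emeasure M B \<and> emeasure M B \<le> ennreal e"
proof -
  interpret sigma_finite_measure M by (rule sf)
  obtain A0 where A0: "A0 \<in> sets M" "A0 \<subseteq> A" "0 < emeasure M A0" "emeasure M A0 < \<infinity>"
  proof -
    obtain F :: "nat \<Rightarrow> 'a set" where F: "range F \<subseteq> sets M" "(\<Union>i. F i) = space M"
        "\<And>i. emeasure M (F i) \<noteq> \<infinity>"
      using sigma_finite by metis
    have "\<exists>i. 0 < emeasure M (A \<inter> F i)"
    proof (rule ccontr)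
      assume "\<not> ?thesis"
      then have "(\<Union>i. A \<inter> F i) \<in> null_sets M"
        using A F(1) by (intro null_sets_UN) (auto simp: null_sets_def zero_less_iff_neq_zero)
      moreover have "(\<Union>i. A \<inter> F i) = A"
        using F(2) sets.sets_into_space[OF A(1)] by auto
      ultimately show False using A(2) by auto
    qed
    then obtain i where i: "0 < emeasure M (A \<inter> F i)" by blast
    have "emeasure M (A \<inter> F i) \<le> emeasure M (F i)"
      using F(1) by (intro emeasure_mono) auto
    then have "emeasure M (A \<inter> F i) < \<infinity>"
      using F(3)[of i] by (simp add: less_top order_le_less_trans)
    with i show ?thesis
      using A(1) F(1) by (intro that[of "A \<inter> F i"]) auto
  qed
  have halving: "\<exists>B\<in>sets M. B \<subseteq> A0 \<and> 0 < emeasure M B \<and> measure M B \<le> measure M A0 / 2 ^ n" for n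
  proof (induction n)
    case 0
    then show ?case using A0 by auto
  next
    case (Suc n)
    then obtain B where B: "B \<in> sets M" "B \<subseteq> A0" "0 < emeasure M B" "measure M B \<le> measure M A0 / 2 ^ n"
      by blast
    have finB: "emeasure M B < \<infinity>"
      using emeasure_mono[OF B(2) A0(1)] A0(4) by (rule order_le_less_trans)
    obtain C where C: "C \<in> sets M" "C \<subseteq> B" "0 < emeasure M C" "emeasure M C < emeasure M B"
      using na B by (auto simp: nonatomic_def)
    have diff: "measure M (B - C) = measure M B - measure M C"
      using B C finB by (intro measure_Diff) (auto simp: less_top)
    have posdiff: "0 < emeasure M (B - C)"
      using B C finB by (subst emeasure_Diff) (auto simp: diff_gr0_ennreal less_top)
    show ?case
    proof (cases "measure M C \<le> measure M B / 2")
      case True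
      then have "measure M C \<le> measure M A0 / 2 ^ Suc n" using B(4) by simp
      then show ?thesis using B C by blast
    next
      case False
      then have "measure M (B - C) \<le> measure M A0 / 2 ^ Suc n" using B(4) diff by simp
      then show ?thesis using B C posdiff by (intro bexI[of _ "B - C"]) auto
    qed
  qed
  obtain n where n: "measure M A0 / e < 2 ^ n"
    using real_arch_pow[of 2 "measure M A0 / e"] by auto
  obtain B where B: "B \<in> sets M" "B \<subseteq> A0" "0 < emeasure M B" "measure M B \<le> measure M A0 / 2 ^ n"
    using halving by blast
  have "measure M B \<le> e"
  proof -
    have "measure M A0 / 2 ^ n \<le> e"
      using n e by (simp add: field_simps less_imp_le)
    with B(4) show ?thesis by linarith
  qed
  moreover have "emeasure M B = ennreal (measure M B)"
    using emeasure_mono[OF B(2) A0(1)] A0(4) by (intro emeasure_eq_ennreal_measure) (auto simp: top_unique)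
  ultimately show ?thesis
    using A0(2) B by (intro bexI[of _ B]) (auto intro: ennreal_leI)
qed

text \<open>Two sets of measure at most \<open>c\<close> have a union of measure at most \<open>c + c\<close>, hence at most \<open>c\<close> by the
  gap.  The sets of measure at most \<open>c\<close> are thus closed under finite and, by monotone limits, countable
  unions, so that one of them, \<open>U\<close>, has the largest measure.  If the whole space had larger measure than
  \<open>c\<close>, a small set of positive measure outside \<open>U\<close> could be added to \<open>U\<close>, against maximality.\<close>

lemma emeasure_space_le_if_gap:
  fixes c :: ennreal
  assumes c: "c < top"
    and small: "\<And>A. A \<in> sets N \<Longrightarrow> 0 < emeasure N A \<Longrightarrow>
      \<exists>B\<in>sets N. B \<subseteq> A \<and> 0 < emeasure N B \<and> emeasure N B \<le> c"
    and gap: "\<And>E. E \<in> sets N \<Longrightarrow> emeasure N E \<le> c + c \<Longrightarrow> emeasure N E \<le> c"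
  shows "emeasure N (space N) \<le> c"
proof (rule ccontr)
  assume big: "\<not> emeasure N (space N) \<le> c"
  define \<D> where "\<D> = {E \<in> sets N. emeasure N E \<le> c}"
  have Un: "E \<union> F \<in> \<D>" if "E \<in> \<D>" "F \<in> \<D>" for E F
  proof -
    have EF: "E \<in> sets N" "F \<in> sets N" "emeasure N E \<le> c" "emeasure N F \<le> c"
      using that by (auto simp: \<D>_def)
    have "emeasure N (E \<union> F) \<le> emeasure N E + emeasure N F"
      using EF by (intro emeasure_subadditive) auto
    also have "\<dots> \<le> c + c"
      using EF by (intro add_mono) auto
    finally show ?thesis
      using gap[of "E \<union> F"] EF by (auto simp: \<D>_def)
  qed
  have empty: "{} \<in> \<D>" by (simp add: \<D>_def)
  obtain r :: "nat \<Rightarrow> ennreal" where r: "range r \<subseteq> emeasure N ` \<D>" "Sup (emeasure N ` \<D>) = Sup (range r)"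
  proof -
    have "emeasure N ` \<D> \<noteq> {}" using empty by blast
    from ennreal_Sup_countable_SUP[OF this] show ?thesis using that by metis
  qed
  have "\<forall>n. \<exists>E. E \<in> \<D> \<and> r n = emeasure N E" using r(1) by blast
  then obtain E where E: "\<And>n. E n \<in> \<D>" "\<And>n. r n = emeasure N (E n)" by metis
  have meas: "E n \<in> sets N" for n using E(1)[of n] by (simp add: \<D>_def)
  define U where "U = (\<Union>n. E n)"
  have fin: "(\<Union>i<n. E i) \<in> \<D>" for n
    by (induction n) (auto simp: empty lessThan_Suc intro!: Un E)
  have "U \<in> \<D>"
  proof -
    have inc: "incseq (\<lambda>n. \<Union>i<n. E i)"
      by (intro incseq_SucI) (auto simp: lessThan_Suc)
    have "(SUP n. emeasure N (\<Union>i<n. E i)) = emeasure N (\<Union>n. \<Union>i<n. E i)"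
      using meas by (intro SUP_emeasure_incseq inc) auto
    moreover have "(\<Union>n. \<Union>i<n. E i) = U"
      by (auto simp: U_def)
    moreover have "(SUP n. emeasure N (\<Union>i<n. E i)) \<le> c"
      using fin by (intro SUP_least) (auto simp: \<D>_def)
    ultimately show ?thesis
      using meas by (auto simp: \<D>_def U_def)
  qed
  then have U: "U \<in> sets N" "emeasure N U \<le> c" by (auto simp: \<D>_def)
  have max: "emeasure N F \<le> emeasure N U" if "F \<in> \<D>" for F
  proof -
    have "emeasure N F \<le> Sup (range r)"
      using that by (subst r(2)[symmetric]) (auto intro: Sup_upper)
    also have "\<dots> \<le> emeasure N U"
      using U(1) by (intro SUP_least) (auto simp: E(2) U_def intro!: emeasure_mono)
    finally show ?thesis .
  qed
  have "0 < emeasure N (space N - U)"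
  proof (rule ccontr)
    assume "\<not> ?thesis"
    moreover have "emeasure N (space N) \<le> emeasure N U + emeasure N (space N - U)"
      using U(1) sets.sets_into_space[OF U(1)]
      by (subst plus_emeasure) (auto intro!: emeasure_mono)
    ultimately show False using big U(2) by (auto simp: zero_less_iff_neq_zero)
  qed
  then obtain B where B: "B \<in> sets N" "B \<subseteq> space N - U" "0 < emeasure N B" "emeasure N B \<le> c"
    using small[of "space N - U"] U(1) by auto
  have "emeasure N U + emeasure N B = emeasure N (U \<union> B)"
    using B U by (intro plus_emeasure) auto
  also have "\<dots> \<le> emeasure N U"
    using B Un[OF \<open>U \<in> \<D>\<close>, of B] by (intro max) (auto simp: \<D>_def)
  finally have "emeasure N U + emeasure N B \<le> emeasure N U + 0" by simp
  moreover have "emeasure N U \<noteq> \<infinity>" using U(2) c by (auto simp: top_unique)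
  ultimately have "emeasure N B \<le> 0"
    by (simp add: ennreal_add_left_cancel_le del: add_0_right)
  with B(3) show False by simp
qed

text \<open>The density is bounded, so a set that is small for \<open>M\<close> is small for the measure with density
  \<open>w\<close>.  Choosing it inside \<open>{t. 0 < w t}\<close> keeps its new measure positive.\<close>

lemma nn_integral_le_if_gap:
  assumes sf: "sigma_finite_measure M" and na: "nonatomic M"
    and w: "w \<in> borel_measurable M" "\<And>t. t \<in> space M \<Longrightarrow> w t \<le> K"
    and c: "0 < (c::real)"
    and gap: "\<And>E. E \<in> sets M \<Longrightarrow> (\<integral>\<^sup>+t\<in>E. ennreal (w t) \<partial>M) \<le> ennreal (2 * c) \<Longrightarrow>
      (\<integral>\<^sup>+t\<in>E. ennreal (w t) \<partial>M) \<le> ennreal c"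
  shows "(\<integral>\<^sup>+t. ennreal (w t) \<partial>M) \<le> ennreal c"
proof -
  note [measurable] = w(1)
  define N where "N = density M (\<lambda>t. ennreal (w t))"
  have N: "emeasure N E = (\<integral>\<^sup>+t\<in>E. ennreal (w t) \<partial>M)" if "E \<in> sets M" for E
    unfolding N_def using that by (intro emeasure_density) auto
  have sets [simp]: "sets N = sets M" and space [simp]: "space N = space M" by (simp_all add: N_def)
  have "emeasure N (space N) \<le> ennreal c"
  proof (rule emeasure_space_le_if_gap)
    fix A assume A: "A \<in> sets N" "0 < emeasure N A"
    let ?A = "A \<inter> {t \<in> space M. 0 < w t}"
    define e where "e = c / max 1 K"
    have e: "0 < e" using c by (simp add: e_def)
    have "0 < emeasure M ?A"
    proof (rule ccontr)
      assume "\<not> ?thesis"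
      then have "?A \<in> null_sets M" using A(1) by (auto simp: null_sets_def)
      then have "AE t in M. t \<notin> ?A" by (rule AE_not_in)
      then have "AE t in M. ennreal (w t) * indicator A t = 0"
        by (rule AE_mp, intro AE_I2) (auto simp: indicator_def ennreal_neg)
      then have "emeasure N A = 0"
        using A(1) by (subst N) (auto simp: nn_integral_0_iff_AE)
      with A(2) show False by simp
    qed
    then obtain B where B: "B \<in> sets M" "B \<subseteq> ?A" "0 < emeasure M B" "emeasure M B \<le> ennreal e"
      using nonatomic_small_subset[OF sf na, of ?A e] A(1) e by auto
    have "0 < emeasure N B"
    proof (rule ccontr)
      assume "\<not> ?thesis"
      then have "AE t in M. ennreal (w t) * indicator B t = 0"
        using B(1) by (simp add: N nn_integral_0_iff_AE)
      then have "AE t in M. t \<notin> B"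
        by (rule AE_mp, intro AE_I2) (use B(2) in \<open>auto simp: indicator_def ennreal_eq_0_iff split: if_splits\<close>)
      then have "emeasure M B = 0"
        using B(1) by (subst (asm) AE_iff_measurable[of B]) (auto dest: sets.sets_into_space)
      with B(3) show False by simp
    qed
    moreover have "emeasure N B \<le> ennreal c"
    proof -
      have "emeasure N B \<le> (\<integral>\<^sup>+t. ennreal (max 1 K) * indicator B t \<partial>M)"
        unfolding N[OF B(1)] using w(2)
        by (intro nn_integral_mono mult_right_mono ennreal_leI) (auto intro: max.coboundedI2)
      also have "\<dots> = ennreal (max 1 K) * emeasure M B"
        using B(1) by (rule nn_integral_cmult_indicator)
      also have "\<dots> \<le> ennreal (max 1 K) * ennreal e"
        by (intro mult_left_mono B) auto
      also have "\<dots> = ennreal c"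
        using e by (subst ennreal_mult[symmetric]) (auto simp: e_def)
      finally show ?thesis .
    qed
    ultimately show "\<exists>B\<in>sets N. B \<subseteq> A \<and> 0 < emeasure N B \<and> emeasure N B \<le> ennreal c"
      using B by auto
  next
    fix E assume "E \<in> sets N" "emeasure N E \<le> ennreal c + ennreal c"
    then show "emeasure N E \<le> ennreal c"
      using gap[of E] c by (simp add: N ennreal_plus[symmetric] del: ennreal_plus)
  qed simp
  then show ?thesis
    by (simp add: N nn_integral_set_ennreal cong: nn_integral_cong)
qed

section \<open>From the embedding to the pointwise inequality\<close>

text \<open>A measurable choice of a maximiser of \<open>e t\<close> among \<open>0\<close> and the first \<open>n\<close> terms of \<open>q\<close>.  Replacing the
  current value only on strict improvement makes the attained maximum increase with \<open>n\<close>.  Starting from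
  \<open>0\<close>, where the excess of the Young functions vanishes, keeps that maximum nonnegative.\<close>

primrec running_argmax :: "('a \<Rightarrow> real \<Rightarrow> real) \<Rightarrow> (nat \<Rightarrow> real) \<Rightarrow> nat \<Rightarrow> 'a \<Rightarrow> real" where
  "running_argmax e q 0 t = 0"
| "running_argmax e q (Suc n) t =
     (let u = running_argmax e q n t in if e t u < e t (q n) then q n else u)"

lemma running_argmax_mono: "e t (running_argmax e q n t) \<le> e t (running_argmax e q (Suc n) t)"
  by (simp add: Let_def)

lemma running_argmax_ge: "e t (q n) \<le> e t (running_argmax e q (Suc n) t)"
  by (simp add: Let_def)

lemma running_argmax_in: "running_argmax e q n t \<in> insert 0 (q ` {..<n})"
  by (induction n) (auto simp: Let_def)

lemma running_argmax_measurable: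
  assumes "(\<lambda>(t, u). e t u) \<in> borel_measurable (M \<Otimes>\<^sub>M borel)"
  shows "running_argmax e q n \<in> borel_measurable M"
proof (induction n)
  case 0
  have "running_argmax e q 0 = (\<lambda>_. 0)" by (simp add: fun_eq_iff)
  then show ?case by simp
next
  case (Suc n)
  note [measurable] = Suc
  have [measurable]: "(\<lambda>t. e t (x t)) \<in> borel_measurable M" if "x \<in> borel_measurable M" for x
    using measurable_compose[OF measurable_Pair[OF measurable_ident that] assms] by simp
  have "running_argmax e q (Suc n) =
      (\<lambda>t. if e t (running_argmax e q n t) < e t (q n) then q n else running_argmax e q n t)"
    by (simp add: fun_eq_iff Let_def)
  then show ?case by simp
qed

text \<open>Here \<open>b = 2\<close> exceeds the constant of the modular bound, and this surplus produces the gap: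
  a set on which the \<open>\<Phi>1\<close>-modular of a maximiser is at most \<open>1\<close> has in fact modular at most \<open>1 / 2\<close>.
  With \<open>b = 1\<close> the argument would give no gap.\<close>

lemma pointwise_inequality_if_modular_bound:
  assumes sf: "sigma_finite_measure M" and na: "nonatomic M"
    and \<Phi>1: "young_function \<Phi>1" and \<Phi>2: "young_function \<Phi>2"
    and h: "h \<in> borel_measurable M" "\<And>t. t \<in> space M \<Longrightarrow> 0 \<le> h t"
    and bound: "\<And>x. x \<in> borel_measurable M \<Longrightarrow> (\<And>t. 0 \<le> x t) \<Longrightarrow>
      (\<integral>\<^sup>+t. ennreal (\<Phi>1 (x t)) \<partial>M) \<le> 1 \<Longrightarrow> (\<integral>\<^sup>+t. ennreal (h t * \<Phi>2 (a * x t)) \<partial>M) \<le> 1"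
  shows "\<exists>g A. integrable M g \<and> A \<in> sets M \<and> emeasure M A = 0 \<and>
    (\<forall>u>0. \<forall>t\<in>space M - A. \<Phi>2 (a * u) * h t \<le> 2 * \<Phi>1 u + g t)"
proof -
  note [measurable] = young_function_borel_measurable[OF \<Phi>1] young_function_borel_measurable[OF \<Phi>2] h(1)
  define e where "e t u = h t * \<Phi>2 (a * u) - 2 * \<Phi>1 u" for t u
  (* The absolute values of the rationals are dense in the nonnegative reals, where u ranges. *)
  define q where "q n = \<bar>from_nat_into \<rat> n :: real\<bar>" for n
  define f where "f = running_argmax e q"
  have [measurable]: "(\<lambda>(t, u). e t u) \<in> borel_measurable (M \<Otimes>\<^sub>M borel)"
    unfolding e_def by measurable
  have [measurable]: "f n \<in> borel_measurable M" for n
    unfolding f_def by (rule running_argmax_measurable) measurable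
  have [measurable]: "(\<lambda>t. e t (f n t)) \<in> borel_measurable M" for n
    unfolding e_def by measurable
  have f_in: "f n t \<in> insert 0 (q ` {..<n})" for n t
    unfolding f_def by (rule running_argmax_in)
  have f_nonneg: "0 \<le> f n t" for n t
    using f_in[of n t] by (auto simp: q_def)
  have e_inc: "incseq (\<lambda>n. e t (f n t))" for t
    unfolding f_def by (intro incseq_SucI running_argmax_mono)
  have e_nonneg: "0 \<le> e t (f n t)" for n t
  proof -
    have "e t (f 0 t) \<le> e t (f n t)" by (intro incseqD[OF e_inc]) simp
    then show ?thesis
      by (simp add: f_def e_def young_function_zero[OF \<Phi>1] young_function_zero[OF \<Phi>2])
  qed
  have on_set: "2 * (\<integral>\<^sup>+t\<in>E. ennreal (\<Phi>1 (f n t)) \<partial>M) + (\<integral>\<^sup>+t\<in>E. ennreal (e t (f n t)) \<partial>M) \<le> 1"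
    if E [measurable]: "E \<in> sets M" and le: "(\<integral>\<^sup>+t\<in>E. ennreal (\<Phi>1 (f n t)) \<partial>M) \<le> 1" for E n
  proof -
    (* Cutting off outside E restricts both modulars to E, as Young functions vanish at 0. *)
    define x where "x t = indicator E t * f n t" for t
    have [measurable]: "x \<in> borel_measurable M" unfolding x_def by measurable
    have "(\<integral>\<^sup>+t. ennreal (\<Phi>1 (x t)) \<partial>M) = (\<integral>\<^sup>+t\<in>E. ennreal (\<Phi>1 (f n t)) \<partial>M)"
      by (intro nn_integral_cong) (auto simp: x_def young_function_zero[OF \<Phi>1] split: split_indicator)
    then have "(\<integral>\<^sup>+t. ennreal (h t * \<Phi>2 (a * x t)) \<partial>M) \<le> 1"
      using le f_nonneg by (intro bound) (auto simp: x_def)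
    moreover have "(\<integral>\<^sup>+t. ennreal (h t * \<Phi>2 (a * x t)) \<partial>M) =
        (\<integral>\<^sup>+t. 2 * (ennreal (\<Phi>1 (f n t)) * indicator E t) + ennreal (e t (f n t)) * indicator E t \<partial>M)"
    proof (rule nn_integral_cong)
      fix t
      have "h t * \<Phi>2 (a * f n t) = 2 * \<Phi>1 (f n t) + e t (f n t)"
        by (simp add: e_def)
      then have "ennreal (h t * \<Phi>2 (a * f n t)) = 2 * ennreal (\<Phi>1 (f n t)) + ennreal (e t (f n t))"
        using e_nonneg young_function_nonneg[OF \<Phi>1]
        by (simp add: ennreal_plus ennreal_mult)
      then show "ennreal (h t * \<Phi>2 (a * x t)) =
          2 * (ennreal (\<Phi>1 (f n t)) * indicator E t) + ennreal (e t (f n t)) * indicator E t"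
        by (auto simp: x_def young_function_zero[OF \<Phi>2] split: split_indicator)
    qed
    ultimately show ?thesis
      by (simp add: nn_integral_add nn_integral_cmult)
  qed
  have on_set_parts: "2 * (\<integral>\<^sup>+t\<in>E. ennreal (\<Phi>1 (f n t)) \<partial>M) \<le> 1"
      "(\<integral>\<^sup>+t\<in>E. ennreal (e t (f n t)) \<partial>M) \<le> 1"
    if "E \<in> sets M" "(\<integral>\<^sup>+t\<in>E. ennreal (\<Phi>1 (f n t)) \<partial>M) \<le> 1" for E n
    by (rule order_trans[OF _ on_set[OF that]], simp)+
  have e_int: "(\<integral>\<^sup>+t. ennreal (e t (f n t)) \<partial>M) \<le> 1" for n
  proof -
    have "(\<integral>\<^sup>+t. ennreal (\<Phi>1 (f n t)) \<partial>M) \<le> ennreal (1 / 2)"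
    proof (rule nn_integral_le_if_gap[OF sf na])
      show "\<Phi>1 (f n t) \<le> Max (\<Phi>1 ` insert 0 (q ` {..<n}))" for t
        using f_in[of n t] by (intro Max_ge) auto
    next
      fix E assume E: "E \<in> sets M" "(\<integral>\<^sup>+t\<in>E. ennreal (\<Phi>1 (f n t)) \<partial>M) \<le> ennreal (2 * (1 / 2))"
      then have "2 * (\<integral>\<^sup>+t\<in>E. ennreal (\<Phi>1 (f n t)) \<partial>M) \<le> 1"
        using on_set_parts(1)[of E n] by simp
      then have "ennreal (1 / 2) * (2 * (\<integral>\<^sup>+t\<in>E. ennreal (\<Phi>1 (f n t)) \<partial>M)) \<le> ennreal (1 / 2) * 1"
        by (rule mult_left_mono) simp
      moreover have "ennreal (1 / 2) * 2 = 1"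
        using ennreal_mult[of "1 / 2" 2] by simp
      ultimately show "(\<integral>\<^sup>+t\<in>E. ennreal (\<Phi>1 (f n t)) \<partial>M) \<le> ennreal (1 / 2)"
        by (simp add: mult.assoc[symmetric])
    qed auto
    also have "\<dots> \<le> 1"
      by (subst ennreal_1[symmetric]) (rule ennreal_leI, simp)
    finally have "(\<integral>\<^sup>+t\<in>space M. ennreal (\<Phi>1 (f n t)) \<partial>M) \<le> 1"
      by (simp add: nn_integral_set_ennreal cong: nn_integral_cong)
    then have "(\<integral>\<^sup>+t\<in>space M. ennreal (e t (f n t)) \<partial>M) \<le> 1"
      using on_set_parts(2)[of "space M" n] by simp
    then show ?thesis
      by (simp add: nn_integral_set_ennreal cong: nn_integral_cong)
  qed
  define G where "G t = (SUP n. ennreal (e t (f n t)))" for t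
  have [measurable]: "G \<in> borel_measurable M" unfolding G_def by measurable
  have "(\<integral>\<^sup>+t. G t \<partial>M) = (SUP n. \<integral>\<^sup>+t. ennreal (e t (f n t)) \<partial>M)"
    unfolding G_def
    by (intro nn_integral_monotone_convergence_SUP)
       (auto simp: incseq_def le_fun_def intro!: ennreal_leI incseqD[OF e_inc])
  also have "\<dots> \<le> 1" by (intro SUP_least e_int)
  finally have G_int: "(\<integral>\<^sup>+t. G t \<partial>M) \<le> 1" .
  define A where "A = {t \<in> space M. G t = \<infinity>}"
  define g where "g t = enn2real (G t)" for t
  have A: "A \<in> sets M" unfolding A_def by measurable
  have fin: "AE t in M. G t \<noteq> \<infinity>"
    using G_int by (intro nn_integral_PInf_AE) (auto simp: top_unique)
  then have A0: "emeasure M A = 0"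
    using A by (subst (asm) AE_iff_measurable[of A]) (auto simp: A_def)
  have "integrable M g"
  proof (rule integrableI_nonneg)
    have "(\<integral>\<^sup>+t. ennreal (g t) \<partial>M) \<le> (\<integral>\<^sup>+t. G t \<partial>M)"
      unfolding g_def by (intro nn_integral_mono) (simp add: ennreal_enn2real_if)
    also have "\<dots> < \<infinity>" by (rule order_le_less_trans[OF G_int]) simp
    finally show "(\<integral>\<^sup>+t. ennreal (g t) \<partial>M) < \<infinity>" .
    show "g \<in> borel_measurable M" unfolding g_def by measurable
  qed (simp add: g_def)
  moreover have "\<Phi>2 (a * u) * h t \<le> 2 * \<Phi>1 u + g t" if u: "0 < u" and t: "t \<in> space M - A" for u t
  proof -
    have e_q: "e t (q n) \<le> g t" for n
    proof -
      have "ennreal (e t (q n)) \<le> ennreal (e t (f (Suc n) t))"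
        unfolding f_def by (intro ennreal_leI running_argmax_ge)
      also have "\<dots> \<le> G t" unfolding G_def by (intro SUP_upper) simp
      also have "\<dots> = ennreal (g t)" using t by (simp add: g_def A_def less_top)
      finally show ?thesis
        by (subst (asm) ennreal_le_iff) (simp_all add: g_def)
    qed
    have "e t \<bar>r\<bar> \<le> g t" if "r \<in> \<rat>" for r
      using e_q that from_nat_into_surj[OF countable_rat that] by (auto simp: q_def)
    moreover have "closed {r. e t \<bar>r\<bar> \<le> g t}"
    proof -
      have "continuous_on UNIV (\<lambda>r. e t \<bar>r\<bar>)"
        unfolding e_def
        by (intro continuous_intros young_function_continuous_on[OF \<Phi>1] young_function_continuous_on[OF \<Phi>2])
      then show ?thesis by (intro closed_Collect_le continuous_intros)
    qed
    ultimately have "closure \<rat> \<subseteq> {r. e t \<bar>r\<bar> \<le> g t}"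
      by (intro closure_minimal) auto
    then have "e t \<bar>u\<bar> \<le> g t"
      by (auto simp: Rats_closure_real)
    with u show ?thesis by (simp add: e_def algebra_simps)
  qed
  ultimately show ?thesis using A A0 by blast
qed

text \<open>A function of \<open>\<Phi>1\<close>-modular at most one has norm at most one, so its weighted norm is below
  \<open>C + 1\<close> and \<open>a = 1 / (C + 1)\<close> qualifies.\<close>

lemma pointwise_inequality_if_embedded:
  assumes sf: "sigma_finite_measure M" and na: "nonatomic M"
    and \<Phi>1: "young_function \<Phi>1" and \<Phi>2: "young_function \<Phi>2"
    and h: "h \<in> borel_measurable M" "\<And>t. t \<in> space M \<Longrightarrow> 0 \<le> h t"
    and emb: "continuously_embedded_weighted M \<Phi>1 h \<Phi>2"
  shows "\<exists>a>0. \<exists>g A. integrable M g \<and> A \<in> sets M \<and> emeasure M A = 0 \<and>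
    (\<forall>u>0. \<forall>t\<in>space M - A. \<Phi>2 (a * u) * h t \<le> 2 * \<Phi>1 u + g t)"
proof -
  obtain C where C: "0 < C"
    "\<And>f. f \<in> orlicz_space M \<Phi>1 \<Longrightarrow> weighted_orlicz_norm M h \<Phi>2 f \<le> C * orlicz_norm M \<Phi>1 f"
    and sub: "orlicz_space M \<Phi>1 \<subseteq> weighted_orlicz_space M h \<Phi>2"
    using emb by (auto simp: continuously_embedded_weighted_def)
  have "(\<integral>\<^sup>+t. ennreal (h t * \<Phi>2 (1 / (C + 1) * x t)) \<partial>M) \<le> 1"
    if x [measurable]: "x \<in> borel_measurable M" and x0: "\<And>t. 0 \<le> x t"
      and x1: "(\<integral>\<^sup>+t. ennreal (\<Phi>1 (x t)) \<partial>M) \<le> 1" for x :: "'a \<Rightarrow> real"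
  proof -
    define f where "f t = complex_of_real (x t)" for t
    have nf: "norm (f t) = x t" for t using x0 by (simp add: f_def)
    have f: "f \<in> orlicz_space M \<Phi>1"
    proof -
      have "f \<in> borel_measurable M" unfolding f_def by measurable
      moreover have "(\<integral>\<^sup>+t. ennreal (\<Phi>1 (1 * norm (f t))) \<partial>M) < \<infinity>"
        using x0 by (simp add: nf order_le_less_trans[OF x1])
      ultimately show ?thesis
        unfolding orlicz_space_def by (auto intro!: exI[of _ 1])
    qed
    have "orlicz_norm M \<Phi>1 f \<le> 1"
      unfolding orlicz_norm_eq_weighted using x1 by (intro weighted_orlicz_norm_le) (auto simp: nf)
    then have "C * orlicz_norm M \<Phi>1 f \<le> C * 1"
      using C(1) by (intro mult_left_mono) auto
    with C(2)[OF f] have "weighted_orlicz_norm M h \<Phi>2 f < C + 1" by linarith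
    from modular_le_one_if_norm_less[OF \<Phi>2 h _ this] f sub show ?thesis
      by (auto simp: nf)
  qed
  note pointwise_inequality_if_modular_bound[OF sf na \<Phi>1 \<Phi>2 h this]
  moreover have "0 < 1 / (C + 1)" using C(1) by simp
  ultimately show ?thesis by blast
qed

section \<open>Equivalence of the three conditions\<close>

theorem theorem2p1:
  fixes M :: "'a measure"
    and \<Phi>1 \<Phi>2 :: "real \<Rightarrow> real"
    and \<phi> :: "'a \<Rightarrow> 'a"
    and h :: "'a \<Rightarrow> real"
  assumes "sigma_finite_measure M"
    and "complete_measure M"
    and "nonatomic M"
    and "young_function \<Phi>1"
    and "young_function \<Phi>2"
    and "\<phi> \<in> measurable M M"
    and "\<phi> ` space M = space M"
    and "nonsingular M \<phi>"
    and "radon_nikodym_of M \<phi> h"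
  shows "(composition_bounded M \<Phi>1 \<Phi>2 \<phi> \<longleftrightarrow> continuously_embedded_weighted M \<Phi>1 h \<Phi>2) \<and>
    (continuously_embedded_weighted M \<Phi>1 h \<Phi>2 \<longleftrightarrow>
      (\<exists>a b :: real. \<exists>g :: 'a \<Rightarrow> real. \<exists>A.
         0 < a \<and> 0 < b \<and> integrable M g \<and> A \<in> sets M \<and> emeasure M A = 0 \<and>
         (\<forall>u>0. \<forall>t\<in>space M - A. \<Phi>2 (a * u) * h t \<le> b * \<Phi>1 u + g t)))"
    (is "_ \<and> (_ \<longleftrightarrow> ?pointwise)")
proof (intro conjI iffI)
  have h: "h \<in> borel_measurable M" "\<And>t. t \<in> space M \<Longrightarrow> 0 \<le> h t"
    using assms(9) by (auto simp: radon_nikodym_of_def)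
  show "composition_bounded M \<Phi>1 \<Phi>2 \<phi> \<Longrightarrow> continuously_embedded_weighted M \<Phi>1 h \<Phi>2"
    and "continuously_embedded_weighted M \<Phi>1 h \<Phi>2 \<Longrightarrow> composition_bounded M \<Phi>1 \<Phi>2 \<phi>"
    using composition_bounded_iff_embedded[OF assms(6,9,5)] by blast+
  show ?pointwise if emb: "continuously_embedded_weighted M \<Phi>1 h \<Phi>2"
  proof -
    obtain a g A where "0 < a" "integrable M g" "A \<in> sets M" "emeasure M A = 0"
      "\<forall>u>0. \<forall>t\<in>space M - A. \<Phi>2 (a * u) * h t \<le> 2 * \<Phi>1 u + g t"
      using pointwise_inequality_if_embedded[OF assms(1,3,4,5) h emb] by blast
    then show ?thesis
      by (intro exI[of _ a] exI[of _ "2::real"] exI[of _ g] exI[of _ A]) auto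
  qed
  show "continuously_embedded_weighted M \<Phi>1 h \<Phi>2" if pw: ?pointwise
  proof -
    obtain a b g A where "0 < a" "0 < b" "integrable M g" "A \<in> sets M" "emeasure M A = 0"
      and "\<forall>u>0. \<forall>t\<in>space M - A. \<Phi>2 (a * u) * h t \<le> b * \<Phi>1 u + g t"
      using pw by blast
    then show ?thesis
      by (intro embedded_if_pointwise_inequality[OF assms(4,5) h, of a b g A]) auto
  qed
qed

end
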